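(* Let the sets $\mathcal{U}_i\subseteq X^*$, $i\in I$, be weak$^*$ compact. If $\bar{x}\in\Omega$ is a highly robust efficient solution of $(P_{\mathcal{U}})$, then $\bar{x}$ is both a set-based robust efficient solution and a worst-case robust efficient solution of $(P_{\mathcal{U}})$.
   Context: Setting: $X$ is a real Banach space with dual $X^*$ and pairing $\langle\cdot,\cdot\rangle$; $p\ge 2$, $I=\{1,\dots,p\}$; $f=(f_1,\dots,f_p):X\to\mathbb{R}^p$; $\Omega\subseteq X$ is nonempty (the robust feasible set); $\mathcal{U}_i\subseteq X^*$, $i\in I$, are nonempty and $\mathcal{U}=\prod_{i=1}^p\mathcal{U}_i$. For $u=(u_1,\dots,u_p)\in\mathcal{U}$ put $f_i(x,u_i)=f_i(x)-\langle u_i,x\rangle$ and $f(x,u)=(f_1(x,u_1),\dots,f_p(x,u_p))$. $(P_u)$ is the problem of minimizing $f(x,u)$ over $x\in\Omega$, and $(P_{\mathcal{U}})$ is the family $(P_u)_{u\in\mathcal{U}}$. Orders on $\mathbb{R}^p$: $a\leqq b$ iff $a_i\le b_i$ for all $i\in I$; $a\le b$ iff $a\leqq b$ and $a\ne b$. $\mathbb{R}^p_{\geq}=\{a\in\mathbb{R}^p: a\geq 0\}$ (componentwise nonnegative and nonzero vectors). A point $\bar x\in\Omega$ is an efficient solution of $\min\varphi(x)$ s.t. $x\in\Omega$ if there is no $x\in\Omega\setminus\{\bar x\}$ with $\varphi(x)\le\varphi(\bar x)$. $\bar x$ is a highly robust efficient solution of $(P_{\mathcal{U}})$ if for every $u\in\mathcal{U}$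 it is an efficient solution of $(P_u)$. Set-based robust efficient: there is no $x\in\Omega$ with $f_{\mathcal{U}}(x)\subseteq f_{\mathcal{U}}(\bar x)-\mathbb{R}^p_{\geq}$, where $f_{\mathcal{U}}(x)=\{f(x,u):u\in\mathcal{U}\}$. Worst-case robust efficient: $\bar x$ is an efficient solution of $\min F^{\mathcal{U}}(x)$ s.t. $x\in\Omega$, where $F^{\mathcal{U}}(x)=(F_1^{\mathcal{U}_1}(x),\dots,F_p^{\mathcal{U}_p}(x))$ and $F_i^{\mathcal{U}_i}(x)=\sup_{u_i\in\mathcal{U}_i}f_i(x,u_i)$. *)

theory Defs
  imports "HOL-Analysis.Analysis"
begin

text \<open>
  The weak-star topology on the dual is the coarsest topology making all evaluations continuous;
  for real-valued functionals this is exactly the strong operator topology of the library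
  (the topology of pointwise convergence).
\<close>

abbreviation weak_star_topology :: "('a::real_normed_vector \<Rightarrow>\<^sub>L real) topology" where
  "weak_star_topology \<equiv> strong_operator_topology"

text \<open>On \<^typ>\<open>real ^ 'p\<close> the library's \<open>\<le>\<close> is the componentwise order (written with a double
  bar in the literature); the relation below additionally requires the vectors to be distinct.\<close>

definition pareto_le :: "real ^ 'p \<Rightarrow> real ^ 'p \<Rightarrow> bool" where
  "pareto_le a b \<longleftrightarrow> a \<le> b \<and> a \<noteq> b"

definition pareto_cone :: "(real ^ 'p) set" where
  "pareto_cone = {a. pareto_le 0 a}"

definition efficient_solution :: "'a set \<Rightarrow> ('a \<Rightarrow> real ^ 'p) \<Rightarrow> 'a \<Rightarrow> bool" where
  "efficient_solution \<Omega> \<phi> xbar \<longleftrightarrow>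
     xbar \<in> \<Omega> \<and> \<not> (\<exists>x \<in> \<Omega> - {xbar}. pareto_le (\<phi> x) (\<phi> xbar))"

definition uncertainty_set ::
    "('p \<Rightarrow> ('a::real_normed_vector \<Rightarrow>\<^sub>L real) set) \<Rightarrow> ('p \<Rightarrow> 'a \<Rightarrow>\<^sub>L real) set" where
  "uncertainty_set U = {u. \<forall>i. u i \<in> U i}"

definition perturbed ::
    "('a::real_normed_vector \<Rightarrow> real ^ 'p) \<Rightarrow> ('p \<Rightarrow> 'a \<Rightarrow>\<^sub>L real) \<Rightarrow> 'a \<Rightarrow> real ^ 'p" where
  "perturbed f u x = (\<chi> i. f x $ i - blinfun_apply (u i) x)"

definition highly_robust_efficient ::
    "('a::real_normed_vector \<Rightarrow> real ^ 'p) \<Rightarrow> 'a set \<Rightarrow> ('p \<Rightarrow> ('a \<Rightarrow>\<^sub>L real) set) \<Rightarrow> 'a \<Rightarrow> bool" where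
  "highly_robust_efficient f \<Omega> U xbar \<longleftrightarrow>
     (\<forall>u \<in> uncertainty_set U. efficient_solution \<Omega> (perturbed f u) xbar)"

definition image_set ::
    "('a::real_normed_vector \<Rightarrow> real ^ 'p) \<Rightarrow> ('p \<Rightarrow> ('a \<Rightarrow>\<^sub>L real) set) \<Rightarrow> 'a \<Rightarrow> (real ^ 'p) set" where
  "image_set f U x = (\<lambda>u. perturbed f u x) ` uncertainty_set U"

definition set_based_robust_efficient ::
    "('a::real_normed_vector \<Rightarrow> real ^ 'p) \<Rightarrow> 'a set \<Rightarrow> ('p \<Rightarrow> ('a \<Rightarrow>\<^sub>L real) set) \<Rightarrow> 'a \<Rightarrow> bool" where
  "set_based_robust_efficient f \<Omega> U xbar \<longleftrightarrow>
     xbar \<in> \<Omega> \<and>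
     \<not> (\<exists>x \<in> \<Omega>. image_set f U x \<subseteq> {a - b | a b. a \<in> image_set f U xbar \<and> b \<in> pareto_cone})"

text \<open>The supremum is taken in the reals, so it has its usual meaning only when the values are
  bounded above; this is the case for nonempty weak-star compact \<open>U i\<close>.\<close>

definition worst_case ::
    "('a::real_normed_vector \<Rightarrow> real ^ 'p) \<Rightarrow> ('p \<Rightarrow> ('a \<Rightarrow>\<^sub>L real) set) \<Rightarrow> 'a \<Rightarrow> real ^ 'p" where
  "worst_case f U x = (\<chi> i. SUP v \<in> U i. f x $ i - blinfun_apply v x)"

definition worst_case_robust_efficient ::
    "('a::real_normed_vector \<Rightarrow> real ^ 'p) \<Rightarrow> 'a set \<Rightarrow> ('p \<Rightarrow> ('a \<Rightarrow>\<^sub>L real) set) \<Rightarrow> 'a \<Rightarrow> bool" where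
  "worst_case_robust_efficient f \<Omega> U xbar \<longleftrightarrow> efficient_solution \<Omega> (worst_case f U) xbar"

end

theory Submission
  imports Defs
begin

text \<open>
  Weak-star compactness makes every worst case attained. Since the \<open>i\<close>-th perturbed objective
  depends on the \<open>i\<close>-th component of the scenario only, and the uncertainty set is a full product,
  the maximisers of the individual objectives form one scenario. Hence the vector of worst-case
  values at \<open>x\<close> is not just an upper bound but the greatest element of the set of perturbed
  values at \<open>x\<close> (\<open>worst_case_in_image_set\<close>, \<open>perturbed_le_worst_case\<close>).

  This one vector separates the objective values at \<open>x\<close> from those at a highly robust efficient
  \<open>xbar\<close>: if it were dominated by the value at \<open>xbar\<close> under some scenario \<open>u\<close>, then the value at
  \<open>x\<close> under the same \<open>u\<close> would be dominated as well, against efficiency of \<open>xbar\<close> for \<open>u\<close>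
  (\<open>highly_robust_efficient_imp_worst_case_not_dominated\<close>). Each of the two failures to be excluded
  yields such a \<open>u\<close>. In the set-based case, the worst-case value at \<open>x\<close> belongs to the image set at
  \<open>x\<close>, so the assumed inclusion supplies \<open>u\<close>. In the worst-case setting, \<open>u\<close> is a scenario that
  attains the worst case at \<open>xbar\<close>.
\<close>

lemma pareto_le_trans_left:
  assumes "a \<le> b" and "pareto_le b c"
  shows "pareto_le a c"
  using assms unfolding pareto_le_def by force

text \<open>Evaluation at \<open>x\<close> is continuous for the weak-star topology, so its image of a compact set of
  functionals is a compact set of reals.\<close>

lemma weak_star_compact_attains_min:
  fixes V :: "('a::real_normed_vector \<Rightarrow>\<^sub>L real) set"
  assumes "compactin weak_star_topology V" and "V \<noteq> {}"
  obtains v where "v \<in> V" and "\<And>w. w \<in> V \<Longrightarrow> blinfun_apply v x \<le> blinfun_apply w x"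
proof -
  have "compact ((\<lambda>v. blinfun_apply v x) ` V)"
    using image_compactin[OF assms(1) strong_operator_topology_continuous_evaluation[of x]]
    by simp
  then show ?thesis
    using compact_attains_inf[of "(\<lambda>v. blinfun_apply v x) ` V"] assms(2) that by auto
qed

lemma worst_case_component_attained:
  fixes U :: "'p::finite \<Rightarrow> ('a::real_normed_vector \<Rightarrow>\<^sub>L real) set"
  assumes "compactin weak_star_topology (U i)" and "U i \<noteq> {}"
  shows "\<exists>v \<in> U i. worst_case f U x $ i = f x $ i - blinfun_apply v x \<and>
           (\<forall>w \<in> U i. f x $ i - blinfun_apply w x \<le> f x $ i - blinfun_apply v x)"
proof -
  obtain v where v: "v \<in> U i" "\<And>w. w \<in> U i \<Longrightarrow> blinfun_apply v x \<le> blinfun_apply w x"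
    using weak_star_compact_attains_min[OF assms] by blast
  have "(SUP w \<in> U i. f x $ i - blinfun_apply w x) = f x $ i - blinfun_apply v x"
    by (rule cSup_eq_maximum) (use v in auto)
  then show ?thesis
    using v by (auto simp: worst_case_def)
qed

text \<open>The worst cases of the single objectives are attained simultaneously because the components
  of a scenario can be chosen independently.\<close>

lemma worst_case_in_image_set:
  fixes U :: "'p::finite \<Rightarrow> ('a::real_normed_vector \<Rightarrow>\<^sub>L real) set"
  assumes "\<And>i. compactin weak_star_topology (U i)" and "\<And>i. U i \<noteq> {}"
  shows "worst_case f U x \<in> image_set f U x"
proof -
  have "\<forall>i. \<exists>v \<in> U i. worst_case f U x $ i = f x $ i - blinfun_apply v x"
    using worst_case_component_attained[of U _ f x] assms by blast
  then obtain u where "\<forall>i. u i \<in> U i \<and> worst_case f U x $ i = f x $ i - blinfun_apply (u i) x"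
    by metis
  then have "u \<in> uncertainty_set U" and "worst_case f U x = perturbed f u x"
    by (auto simp: uncertainty_set_def perturbed_def vec_eq_iff)
  then show ?thesis
    by (auto simp: image_set_def)
qed

lemma perturbed_le_worst_case:
  fixes U :: "'p::finite \<Rightarrow> ('a::real_normed_vector \<Rightarrow>\<^sub>L real) set"
  assumes "\<And>i. compactin weak_star_topology (U i)" and "u \<in> uncertainty_set U"
  shows "perturbed f u x \<le> worst_case f U x"
  unfolding less_eq_vec_def
proof
  fix i
  have "u i \<in> U i"
    using assms(2) by (simp add: uncertainty_set_def)
  then have "f x $ i - blinfun_apply (u i) x \<le> worst_case f U x $ i"
    using worst_case_component_attained[of U i f x] assms(1)[of i] by force
  then show "perturbed f u x $ i \<le> worst_case f U x $ i"
    by (simp add: perturbed_def)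
qed

text \<open>The comparison is between the worst case at \<open>x\<close> and an arbitrary scenario at \<open>xbar\<close>. Lowering
  the former to the value at \<open>x\<close> under that same scenario keeps the domination, and efficiency of
  \<open>xbar\<close> for this scenario forbids it.\<close>

lemma highly_robust_efficient_imp_worst_case_not_dominated:
  fixes U :: "'p::finite \<Rightarrow> ('a::real_normed_vector \<Rightarrow>\<^sub>L real) set"
  assumes "\<And>i. compactin weak_star_topology (U i)"
    and "highly_robust_efficient f \<Omega> U xbar"
    and "x \<in> \<Omega>" and "y \<in> image_set f U xbar"
  shows "\<not> pareto_le (worst_case f U x) y"
proof
  assume dom: "pareto_le (worst_case f U x) y"
  obtain u where u: "u \<in> uncertainty_set U" "y = perturbed f u xbar"
    using assms(4) by (auto simp: image_set_def)
  have *: "pareto_le (perturbed f u x) (perturbed f u xbar)"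
    using pareto_le_trans_left[OF perturbed_le_worst_case[OF assms(1) u(1)] dom] u(2) by simp
  then have "x \<noteq> xbar"
    by (auto simp: pareto_le_def)
  with * u(1) assms(2,3) show False
    unfolding highly_robust_efficient_def efficient_solution_def by blast
qed

theorem theorem4:
  fixes f :: "'a::banach \<Rightarrow> real ^ 'p"
    and \<Omega> :: "'a set"
    and U :: "'p::finite \<Rightarrow> ('a \<Rightarrow>\<^sub>L real) set"
    and xbar :: 'a
  assumes "CARD('p) \<ge> 2"
    and "\<Omega> \<noteq> {}"
    and "\<And>i. U i \<noteq> {}"
    and "\<And>i. compactin weak_star_topology (U i)"
    and "xbar \<in> \<Omega>"
    and "highly_robust_efficient f \<Omega> U xbar"
  shows "set_based_robust_efficient f \<Omega> U xbar \<and> worst_case_robust_efficient f \<Omega> U xbar"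
proof
  have not_dominated: "\<not> pareto_le (worst_case f U x) y"
    if "x \<in> \<Omega>" "y \<in> image_set f U xbar" for x y
    using highly_robust_efficient_imp_worst_case_not_dominated assms(4,6) that by blast
  have attained: "worst_case f U x \<in> image_set f U x" for x
    using assms(3,4) by (intro worst_case_in_image_set)
  show "set_based_robust_efficient f \<Omega> U xbar"
    unfolding set_based_robust_efficient_def
  proof (intro conjI notI assms(5))
    assume "\<exists>x \<in> \<Omega>. image_set f U x \<subseteq> {a - b | a b. a \<in> image_set f U xbar \<and> b \<in> pareto_cone}"
    then obtain x a b where "x \<in> \<Omega>" and a: "a \<in> image_set f U xbar"
      and b: "b \<in> pareto_cone" and eq: "worst_case f U x = a - b"
      using attained by blast
    have "pareto_le (worst_case f U x) a"
      using b unfolding eq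
      by (auto simp: pareto_cone_def pareto_le_def less_eq_vec_def vec_eq_iff)
    with not_dominated \<open>x \<in> \<Omega>\<close> a show False
      by blast
  qed
  show "worst_case_robust_efficient f \<Omega> U xbar"
    unfolding worst_case_robust_efficient_def efficient_solution_def
    using not_dominated attained assms(5) by blast
qed

end
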